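(* Let $\mathcal{S}$ be a (possibly empty) set of substitution-closed linear structural rules. Cut elimination holds for $\mathbf{SKt}+\mathcal{S}$ (the system $\mathbf{SKt}$ extended with the rules in $\mathcal{S}$).
   Context: Formulae are in negation normal form over $a,\neg a,\lor,\land,\square,\blacksquare,\lozenge,\lozenge^{\bullet}$, where $\lozenge^{\bullet}$ is the past diamond (dual of $\blacksquare$) and $\overline A$ is the nnf of the negation of $A$. Nested sequents are multisets of formulae and structures $\circ\{\Gamma\}$, $\bullet\{\Delta\}$ with $\Gamma,\Delta$ nested sequents; $\Sigma[\,]$ denotes a context (sequent with a hole). $\mathbf{SKt}$ has the rules: $id$: $\Gamma,a,\overline a$; $cut$: from $\Gamma,A$ and $\Delta,\overline A$ infer $\Gamma,\Delta$; $\land$: from $\Gamma,A$ and $\Gamma,B$ infer $\Gamma,A\land B$; $\lor$: from $\Gamma,A,B$ infer $\Gamma,A\lor B$; $ctr$: from $\Gamma,\Delta,\Delta$ infer $\Gamma,\Delta$; $wk$: from $\Gamma$ infer $\Gamma,\Delta$; $rf$: from $\Gamma,\circ\{\Delta\}$ infer $\bullet\{\Gamma\},\Delta$; $rp$: from $\Gamma,\bullet\{\Delta\}$ infer $\circ\{\Gamma\},\Delta$; $\blacksquare$: from $\Gamma,\bullet\{A\}$ infer $\Gamma,\blacksquare A$; $\square$: from $\Gamma,\circ\{A\}$ infer $\Gamma,\square A$; $\lozenge^{\bullet}$: from $\Gamma,\bullet\{\Delta,A\}$ infer $\Gamma,\bullet\{\Delta\},\lozenge^{\bullet}A$; $\lozenge$: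 from $\Gamma,\circ\{\Delta,A\}$ infer $\Gamma,\circ\{\Delta\},\lozenge A$. A structural rule (one premise) is linear if in every instance the multiset of formula occurrences of the premise equals that of the conclusion, with an induced bijection between occurrences (rules given by finite schemata without side conditions). It is substitution-closed if, whenever $\Sigma'[A]/\Sigma[A]$ is an instance with $A$ an occurrence shared between premise and conclusion, then $\Sigma'[\Delta]/\Sigma[\Delta]$ is also an instance for any structure $\Delta$. *)

theory Defs
  imports Main "HOL-Library.Multiset"
begin

text \<open>Formulae of tense logic in negation normal form.  The black modalities are the
  past ones.\<close>

type_synonym atom = nat

datatype fm =
    Pos atom | Neg atom
  | Or fm fm | And fm fm
  | Box fm | BBox fm
  | Dia fm | BDia fm

primrec dual :: "fm \<Rightarrow> fm" where
  "dual (Pos a) = Neg a"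
| "dual (Neg a) = Pos a"
| "dual (Or A B) = And (dual A) (dual B)"
| "dual (And A B) = Or (dual A) (dual B)"
| "dual (Box A) = Dia (dual A)"
| "dual (BBox A) = BDia (dual A)"
| "dual (Dia A) = Box (dual A)"
| "dual (BDia A) = BBox (dual A)"

text \<open>Nested sequents.  The type of leaves is a parameter: it is \<open>fm\<close> for ordinary
  sequents, and \<open>tag \<times> fm\<close> below, where formula occurrences have to be told apart.
  \<open>Circ \<Gamma>\<close> is the future structure (matching \<open>Box\<close>), \<open>Bull \<Gamma>\<close> the past one.\<close>

datatype 'a struct =
    Fm 'a
  | Circ "'a struct multiset"
  | Bull "'a struct multiset"

type_synonym 'a nseq = "'a struct multiset"

type_synonym sequent = "fm nseq"

text \<open>Sequents with exactly one hole: the hole together with its siblings \<open>\<Gamma>\<close>, or siblings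
  \<open>\<Gamma>\<close> together with a structure that contains the hole.\<close>

datatype 'a ctx =
    CHole "'a struct multiset"
  | CCirc "'a struct multiset" "'a ctx"
  | CBull "'a struct multiset" "'a ctx"

primrec fill :: "'a ctx \<Rightarrow> 'a nseq \<Rightarrow> 'a nseq" where
  "fill (CHole \<Gamma>) \<Delta> = \<Gamma> + \<Delta>"
| "fill (CCirc \<Gamma> C) \<Delta> = \<Gamma> + {#Circ (fill C \<Delta>)#}"
| "fill (CBull \<Gamma> C) \<Delta> = \<Gamma> + {#Bull (fill C \<Delta>)#}"

primrec struct_occs :: "'a struct \<Rightarrow> 'a multiset" where
  "struct_occs (Fm a) = {#a#}"
| "struct_occs (Circ \<Gamma>) = \<Sum>\<^sub># (image_mset struct_occs \<Gamma>)"
| "struct_occs (Bull \<Gamma>) = \<Sum>\<^sub># (image_mset struct_occs \<Gamma>)"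

definition occs :: "'a nseq \<Rightarrow> 'a multiset" where
  "occs \<Gamma> = \<Sum>\<^sub># (image_mset struct_occs \<Gamma>)"


text \<open>A schema is a finite expression built from metavariables for nested sequents, for
  formulae and for contexts (\<open>SCtx i \<Gamma>\<close> is the \<open>i\<close>-th context metavariable with its hole
  filled by \<open>\<Gamma>\<close>) using the structural connectives.  A structural rule is given by finitely
  many premise/conclusion pairs of schemata; its instances are all the results of
  instantiating the metavariables, without side conditions.\<close>

datatype schema_item =
    SSeq nat
  | SFm nat
  | SCtx nat "schema_item multiset"
  | SCirc "schema_item multiset"
  | SBull "schema_item multiset"

type_synonym schema = "schema_item multiset"

type_synonym structural_rule = "(schema \<times> schema) set"

record 'a valuation =
  val_seq :: "nat \<Rightarrow> 'a struct multiset"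
  val_fm :: "nat \<Rightarrow> 'a"
  val_ctx :: "nat \<Rightarrow> 'a ctx"

primrec inst_item :: "'a valuation \<Rightarrow> schema_item \<Rightarrow> 'a nseq" where
  "inst_item \<sigma> (SSeq i) = val_seq \<sigma> i"
| "inst_item \<sigma> (SFm i) = {#Fm (val_fm \<sigma> i)#}"
| "inst_item \<sigma> (SCtx i \<Gamma>) = fill (val_ctx \<sigma> i) (\<Sum>\<^sub># (image_mset (inst_item \<sigma>) \<Gamma>))"
| "inst_item \<sigma> (SCirc \<Gamma>) = {#Circ (\<Sum>\<^sub># (image_mset (inst_item \<sigma>) \<Gamma>))#}"
| "inst_item \<sigma> (SBull \<Gamma>) = {#Bull (\<Sum>\<^sub># (image_mset (inst_item \<sigma>) \<Gamma>))#}"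

definition inst :: "'a valuation \<Rightarrow> schema \<Rightarrow> 'a nseq" where
  "inst \<sigma> \<Gamma> = \<Sum>\<^sub># (image_mset (inst_item \<sigma>) \<Gamma>)"

definition instances :: "structural_rule \<Rightarrow> (sequent \<times> sequent) set" where
  "instances R = {(inst \<sigma> p, inst \<sigma> q) | \<sigma> p q. (p, q) \<in> R}"


text \<open>The bijection between the formula occurrences of the premise and of the conclusion
  that a rule induces relates occurrences with the same origin in the value of a
  metavariable.  To make it visible, values are taken over tagged formulae: a tag consists
  of the metavariable an occurrence comes from and a number which tells it apart from the
  other occurrences in the value of that metavariable.  Two occurrences in an instance
  are then related iff they carry the same tag.\<close>

datatype mvar = MSeq nat | MFm nat | MCtx nat

type_synonym tag = "mvar \<times> nat"

primrec mvar_occs :: "'a valuation \<Rightarrow> mvar \<Rightarrow> 'a multiset" where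
  "mvar_occs \<sigma> (MSeq i) = occs (val_seq \<sigma> i)"
| "mvar_occs \<sigma> (MFm i) = {#val_fm \<sigma> i#}"
| "mvar_occs \<sigma> (MCtx i) = occs (fill (val_ctx \<sigma> i) {#})"

definition distinct_tags :: "(tag \<times> fm) multiset \<Rightarrow> bool" where
  "distinct_tags M \<longleftrightarrow> (\<forall>t. count (image_mset fst M) t \<le> 1)"

definition tagged :: "(tag \<times> fm) valuation \<Rightarrow> bool" where
  "tagged \<sigma> \<longleftrightarrow>
     (\<forall>v. distinct_tags (mvar_occs \<sigma> v) \<and> (\<forall>((w, k), A) \<in># mvar_occs \<sigma> v. w = v))"

text \<open>Equality of the multisets of tagged formulae says that the same formulae occur in the
  premise and in the conclusion and that tags match; distinctness of the tags says that the
  matching is a bijection between occurrences.\<close>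

definition linear_rule :: "structural_rule \<Rightarrow> bool" where
  "linear_rule R \<longleftrightarrow>
     (\<forall>(p, q) \<in> R. \<forall>\<sigma>. tagged \<sigma> \<longrightarrow>
        occs (inst \<sigma> p) = occs (inst \<sigma> q) \<and>
        distinct_tags (occs (inst \<sigma> p)))"

text \<open>\<open>map_ctx snd\<close> erases the tags in a context.  \<open>\<Delta>\<close> is any nested sequent, the empty
  one included.\<close>

definition substitution_closed :: "structural_rule \<Rightarrow> bool" where
  "substitution_closed R \<longleftrightarrow>
     (\<forall>(p, q) \<in> R. \<forall>\<sigma> C' C t A.
        tagged \<sigma> \<and>
        inst \<sigma> p = fill C' {#Fm (t, A)#} \<and>
        inst \<sigma> q = fill C {#Fm (t, A)#} \<longrightarrow>
        (\<forall>\<Delta>. (fill (map_ctx snd C') \<Delta>, fill (map_ctx snd C) \<Delta>) \<in> instances R))"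


text \<open>Derivability in SKt extended with the structural rules in \<open>S\<close>; the flag \<open>c\<close> tells
  whether the cut rule may be used.\<close>

inductive derivable :: "bool \<Rightarrow> structural_rule set \<Rightarrow> sequent \<Rightarrow> bool"
  for c :: bool and S :: "structural_rule set" where
  id: "derivable c S (\<Gamma> + {#Fm (Pos a), Fm (Neg a)#})"
| cut: "\<lbrakk>c; derivable c S (\<Gamma> + {#Fm A#}); derivable c S (\<Delta> + {#Fm (dual A)#})\<rbrakk>
    \<Longrightarrow> derivable c S (\<Gamma> + \<Delta>)"
| conj: "\<lbrakk>derivable c S (\<Gamma> + {#Fm A#}); derivable c S (\<Gamma> + {#Fm B#})\<rbrakk>
    \<Longrightarrow> derivable c S (\<Gamma> + {#Fm (And A B)#})"
| disj: "derivable c S (\<Gamma> + {#Fm A, Fm B#}) \<Longrightarrow> derivable c S (\<Gamma> + {#Fm (Or A B)#})"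
| ctr: "derivable c S (\<Gamma> + \<Delta> + \<Delta>) \<Longrightarrow> derivable c S (\<Gamma> + \<Delta>)"
| wk: "derivable c S \<Gamma> \<Longrightarrow> derivable c S (\<Gamma> + \<Delta>)"
| rf: "derivable c S (\<Gamma> + {#Circ \<Delta>#}) \<Longrightarrow> derivable c S ({#Bull \<Gamma>#} + \<Delta>)"
| rp: "derivable c S (\<Gamma> + {#Bull \<Delta>#}) \<Longrightarrow> derivable c S ({#Circ \<Gamma>#} + \<Delta>)"
| bbox: "derivable c S (\<Gamma> + {#Bull {#Fm A#}#}) \<Longrightarrow> derivable c S (\<Gamma> + {#Fm (BBox A)#})"
| box: "derivable c S (\<Gamma> + {#Circ {#Fm A#}#}) \<Longrightarrow> derivable c S (\<Gamma> + {#Fm (Box A)#})"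
| bdia: "derivable c S (\<Gamma> + {#Bull (\<Delta> + {#Fm A#})#})
    \<Longrightarrow> derivable c S (\<Gamma> + {#Bull \<Delta>#} + {#Fm (BDia A)#})"
| dia: "derivable c S (\<Gamma> + {#Circ (\<Delta> + {#Fm A#})#})
    \<Longrightarrow> derivable c S (\<Gamma> + {#Circ \<Delta>#} + {#Fm (Dia A)#})"
| structural: "\<lbrakk>R \<in> S; (P, Q) \<in> instances R; derivable c S P\<rbrakk> \<Longrightarrow> derivable c S Q"

abbreviation SKt :: "structural_rule set \<Rightarrow> sequent \<Rightarrow> bool" where
  "SKt \<equiv> derivable True"

abbreviation SKt_cut_free :: "structural_rule set \<Rightarrow> sequent \<Rightarrow> bool" where
  "SKt_cut_free \<equiv> derivable False"

end

theory Submission imports Defs begin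

text \<open>A cut is eliminated as in display logic.  In the derivation of \<open>\<Gamma>, A\<close> the occurrences of
  \<open>A\<close> that are ancestors of the cut formula are replaced by \<open>\<Delta>\<close>, at any depth; this commutes
  with all rules except those that introduce \<open>A\<close>.  There it remains to treat, by doing the same in
  the derivation of \<open>\<Delta>, dual A\<close>, a cut whose two cut formulae are principal, which reduces to cuts
  on subformulae.

  A structural rule allows to replace one occurrence at a time, and after each replacement the new
  instance may come with an unrelated matching of occurrences.  Therefore the occurrences of \<open>A\<close> are
  first replaced one by one by a fresh formula \<open>x\<close>, and then those of \<open>x\<close> by \<open>\<Delta>\<close>: since no
  other \<open>x\<close> is around, the matching cannot go astray.\<close>

section \<open>Occurrences, contexts and substitution\<close>

abbreviation map_seq :: "('a \<Rightarrow> 'b) \<Rightarrow> 'a nseq \<Rightarrow> 'b nseq" where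
  "map_seq f \<equiv> image_mset (map_struct f)"

lemma occs_simps [simp]:
  "occs {#} = {#}"
  "occs (\<Gamma> + \<Delta>) = occs \<Gamma> + occs \<Delta>"
  "occs (add_mset s \<Gamma>) = struct_occs s + occs \<Gamma>"
  by (simp_all add: occs_def)

lemma struct_occs_nest [simp]:
  "struct_occs (Circ \<Gamma>) = occs \<Gamma>"
  "struct_occs (Bull \<Gamma>) = occs \<Gamma>"
  by (simp_all add: occs_def)

declare struct_occs.simps(2,3) [simp del]

lemma image_mset_sum_mset: "image_mset f (\<Sum>\<^sub># M) = \<Sum>\<^sub># (image_mset (image_mset f) M)"
  by (induction M) auto

lemma struct_occs_map: "struct_occs (map_struct f s) = image_mset f (struct_occs s)"
  by (induction s)
    (auto simp: occs_def image_mset_sum_mset image_mset.compositionality comp_def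
      intro!: arg_cong[of _ _ sum_mset] image_mset_cong)

lemma occs_map_seq: "occs (map_seq f \<Gamma>) = image_mset f (occs \<Gamma>)"
  by (induction \<Gamma>) (auto simp: struct_occs_map)

lemma occs_fill: "occs (fill C \<Delta>) = occs (fill C {#}) + occs \<Delta>"
  by (induction C) auto

lemma occs_fill_Fm: "occs (fill C {#Fm a#}) = add_mset a (occs (fill C {#}))"
  by (subst occs_fill) simp

lemma map_seq_fill: "map_seq f (fill C \<Delta>) = fill (map_ctx f C) (map_seq f \<Delta>)"
  by (induction C) auto

text \<open>The extra siblings are absorbed into the outermost sibling multiset. One context
  \<open>C'\<close> serves every filling, so the hole can be refilled later.\<close>

lemma fill_add: "\<exists>C'. \<forall>\<Delta>. fill C' \<Delta> = \<Gamma> + fill C \<Delta>"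
proof (cases C)
  case (CHole \<Theta>)
  then show ?thesis by (intro exI[of _ "CHole (\<Gamma> + \<Theta>)"]) (simp add: ac_simps)
next
  case (CCirc \<Theta> D)
  then show ?thesis by (intro exI[of _ "CCirc (\<Gamma> + \<Theta>) D"]) (simp add: ac_simps)
next
  case (CBull \<Theta> D)
  then show ?thesis by (intro exI[of _ "CBull (\<Gamma> + \<Theta>) D"]) (simp add: ac_simps)
qed

text \<open>The induction descends to a leaf that carries \<open>a\<close>; what surrounds it forms
  the context. The singleton appears because \<open>fill\<close> returns a sequent, not a
  structure.\<close>

lemma struct_occs_fillE:
  "a \<in># struct_occs s \<Longrightarrow> \<exists>C. {#s#} = fill C {#Fm a#}"
proof (induction s)
  case (Fm b)
  then show ?case by (intro exI[of _ "CHole {#}"]) simp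
next
  case (Circ \<Gamma>)
  then obtain s where s: "s \<in># \<Gamma>" "a \<in># struct_occs s" by (auto simp: occs_def)
  with Circ.IH obtain C where C: "{#s#} = fill C {#Fm a#}" by blast
  from s obtain \<Gamma>' where \<Gamma>: "\<Gamma> = \<Gamma>' + {#s#}" by (metis insert_DiffM2)
  obtain D where "\<forall>\<Delta>. fill D \<Delta> = \<Gamma>' + fill C \<Delta>" using fill_add by blast
  with C \<Gamma> show ?case by (intro exI[of _ "CCirc {#} D"]) simp
next
  case (Bull \<Gamma>)
  then obtain s where s: "s \<in># \<Gamma>" "a \<in># struct_occs s" by (auto simp: occs_def)
  with Bull.IH obtain C where C: "{#s#} = fill C {#Fm a#}" by blast
  from s obtain \<Gamma>' where \<Gamma>: "\<Gamma> = \<Gamma>' + {#s#}" by (metis insert_DiffM2)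
  obtain D where "\<forall>\<Delta>. fill D \<Delta> = \<Gamma>' + fill C \<Delta>" using fill_add by blast
  with C \<Gamma> show ?case by (intro exI[of _ "CBull {#} D"]) simp
qed

lemma occs_fillE:
  assumes "a \<in># occs \<Gamma>"
  obtains C where "\<Gamma> = fill C {#Fm a#}"
proof -
  from assms obtain s where s: "s \<in># \<Gamma>" "a \<in># struct_occs s" by (auto simp: occs_def)
  from struct_occs_fillE[OF s(2)] obtain C where C: "{#s#} = fill C {#Fm a#}" by blast
  from s obtain \<Gamma>' where \<Gamma>: "\<Gamma> = \<Gamma>' + {#s#}" by (metis insert_DiffM2)
  obtain D where "\<forall>\<Delta>. fill D \<Delta> = \<Gamma>' + fill C \<Delta>" using fill_add by blast
  then have "\<Gamma> = fill D {#Fm a#}" unfolding \<Gamma> C by simp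
  then show thesis by (rule that)
qed

lemma map_struct_eq_iff:
  "map_struct f s = Fm b \<longleftrightarrow> (\<exists>a. s = Fm a \<and> f a = b)"
  "map_struct f s = Circ \<Delta> \<longleftrightarrow> (\<exists>\<Gamma>. s = Circ \<Gamma> \<and> map_seq f \<Gamma> = \<Delta>)"
  "map_struct f s = Bull \<Delta> \<longleftrightarrow> (\<exists>\<Gamma>. s = Bull \<Gamma> \<and> map_seq f \<Gamma> = \<Delta>)"
  by (cases s; auto)+

lemma image_mset_eq_plusE:
  assumes "image_mset f M = X + Y"
  obtains M1 M2 where "M = M1 + M2" "image_mset f M1 = X" "image_mset f M2 = Y"
  using image_mset_eq_plusD[OF assms] that by blast

lemma image_mset_eq_add_msetE:
  assumes "image_mset f M = add_mset y Y"
  obtains a M' where "M = add_mset a M'" "f a = y" "image_mset f M' = Y"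
  using msed_map_invR[OF assms] that by blast

text \<open>A context found after relabelling pulls back level by level. With \<open>f\<close>
  erasing tags, this recovers the tagged context behind a visible occurrence.\<close>

lemma map_seq_eq_fill:
  "map_seq f \<Gamma> = fill C {#Fm b#} \<Longrightarrow>
    \<exists>C' a. \<Gamma> = fill C' {#Fm a#} \<and> map_ctx f C' = C \<and> f a = b"
proof (induction C arbitrary: \<Gamma>)
  case (CHole \<Theta>)
  then obtain s \<Gamma>' where "\<Gamma> = add_mset s \<Gamma>'" "map_struct f s = Fm b" "map_seq f \<Gamma>' = \<Theta>"
    by (auto elim: image_mset_eq_add_msetE)
  then show ?case by (intro exI[of _ "CHole \<Gamma>'"]) (auto simp: map_struct_eq_iff)
next
  case (CCirc \<Theta> C)
  then obtain \<Delta> \<Gamma>' where 1: "\<Gamma> = add_mset (Circ \<Delta>) \<Gamma>'" "map_seq f \<Gamma>' = \<Theta>"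
    "map_seq f \<Delta> = fill C {#Fm b#}"
    by (auto simp: map_struct_eq_iff elim!: image_mset_eq_add_msetE)
  from CCirc.IH[OF 1(3)] obtain C' a
    where "\<Delta> = fill C' {#Fm a#}" "map_ctx f C' = C" "f a = b" by blast
  with 1 show ?case by (intro exI[of _ "CCirc \<Gamma>' C'"]) auto
next
  case (CBull \<Theta> C)
  then obtain \<Delta> \<Gamma>' where 1: "\<Gamma> = add_mset (Bull \<Delta>) \<Gamma>'" "map_seq f \<Gamma>' = \<Theta>"
    "map_seq f \<Delta> = fill C {#Fm b#}"
    by (auto simp: map_struct_eq_iff elim!: image_mset_eq_add_msetE)
  from CBull.IH[OF 1(3)] obtain C' a
    where "\<Delta> = fill C' {#Fm a#}" "map_ctx f C' = C" "f a = b" by blast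
  with 1 show ?case by (intro exI[of _ "CBull \<Gamma>' C'"]) auto
qed

section \<open>Substitution of nested sequents for leaves\<close>

text \<open>This is the monadic bind of structures. It returns a multiset because a leaf may give
  way to no structure or to several.\<close>

primrec bind_struct :: "('a \<Rightarrow> 'b nseq) \<Rightarrow> 'a struct \<Rightarrow> 'b nseq" where
  "bind_struct g (Fm a) = g a"
| "bind_struct g (Circ \<Gamma>) = {#Circ (\<Sum>\<^sub># (image_mset (bind_struct g) \<Gamma>))#}"
| "bind_struct g (Bull \<Gamma>) = {#Bull (\<Sum>\<^sub># (image_mset (bind_struct g) \<Gamma>))#}"

definition bind_seq :: "('a \<Rightarrow> 'b nseq) \<Rightarrow> 'a nseq \<Rightarrow> 'b nseq" where
  "bind_seq g \<Gamma> = \<Sum>\<^sub># (image_mset (bind_struct g) \<Gamma>)"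

lemma bind_seq_simps [simp]:
  "bind_seq g {#} = {#}"
  "bind_seq g (\<Gamma> + \<Delta>) = bind_seq g \<Gamma> + bind_seq g \<Delta>"
  "bind_seq g (add_mset s \<Gamma>) = bind_struct g s + bind_seq g \<Gamma>"
  by (simp_all add: bind_seq_def)

lemma bind_struct_nest [simp]:
  "bind_struct g (Circ \<Gamma>) = {#Circ (bind_seq g \<Gamma>)#}"
  "bind_struct g (Bull \<Gamma>) = {#Bull (bind_seq g \<Gamma>)#}"
  by (simp_all add: bind_seq_def)

declare bind_struct.simps(2,3) [simp del]

lemma bind_seq_cong_struct:
  "(\<And>s. s \<in># \<Gamma> \<Longrightarrow> bind_struct g s = bind_struct h s) \<Longrightarrow> bind_seq g \<Gamma> = bind_seq h \<Gamma>"
  by (induction \<Gamma>) auto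

lemma bind_struct_cong:
  "(\<And>a. a \<in># struct_occs s \<Longrightarrow> g a = h a) \<Longrightarrow> bind_struct g s = bind_struct h s"
  by (induction s) (force simp: occs_def intro: bind_seq_cong_struct)+

lemma bind_seq_cong:
  "(\<And>a. a \<in># occs \<Gamma> \<Longrightarrow> g a = h a) \<Longrightarrow> bind_seq g \<Gamma> = bind_seq h \<Gamma>"
  by (rule bind_seq_cong_struct, rule bind_struct_cong) (auto simp: occs_def)

lemma bind_struct_map: "bind_struct g (map_struct f s) = bind_struct (g \<circ> f) s"
  by (induction s)
    (auto simp: bind_seq_def image_mset.compositionality comp_def
      intro!: arg_cong[of _ _ sum_mset] image_mset_cong)

lemma bind_seq_map: "bind_seq g (map_seq f \<Gamma>) = bind_seq (g \<circ> f) \<Gamma>"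
  by (induction \<Gamma>) (auto simp: bind_struct_map comp_def)

lemma sum_mset_singletons:
  "(\<And>x. x \<in># M \<Longrightarrow> g x = {#f x#}) \<Longrightarrow> \<Sum>\<^sub># (image_mset g M) = image_mset f M"
  by (induction M) auto

lemma map_struct_eq_bind: "bind_struct (\<lambda>a. {#Fm (f a)#}) s = {#map_struct f s#}"
  by (induction s) (auto simp: bind_seq_def intro!: sum_mset_singletons)

lemma map_seq_eq_bind: "map_seq f \<Gamma> = bind_seq (\<lambda>a. {#Fm (f a)#}) \<Gamma>"
  by (induction \<Gamma>) (auto simp: map_struct_eq_bind)

lemma map_seq_cong: "(\<And>a. a \<in># occs \<Gamma> \<Longrightarrow> f a = h a) \<Longrightarrow> map_seq f \<Gamma> = map_seq h \<Gamma>"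
  unfolding map_seq_eq_bind by (rule bind_seq_cong) simp

lemma map_seq_map_seq: "map_seq f (map_seq h \<Gamma>) = map_seq (f \<circ> h) \<Gamma>"
  by (simp add: image_mset.compositionality comp_def struct.map_comp)

lemma map_seq_ident: "(\<And>a. a \<in># occs \<Gamma> \<Longrightarrow> f a = a) \<Longrightarrow> map_seq f \<Gamma> = \<Gamma>"
  using map_seq_cong[of \<Gamma> f id] by (simp add: struct.map_id0)

lemma bind_seq_ident: "(\<And>a. a \<in># occs \<Gamma> \<Longrightarrow> g a = {#Fm a#}) \<Longrightarrow> bind_seq g \<Gamma> = \<Gamma>"
  using bind_seq_cong[of \<Gamma> g "\<lambda>a. {#Fm (id a)#}"]
  by (simp flip: map_seq_eq_bind add: map_seq_ident)

lemma bind_seq_fill_cong: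
  "bind_seq g \<Delta> = bind_seq g \<Delta>' \<Longrightarrow> bind_seq g (fill C \<Delta>) = bind_seq g (fill C \<Delta>')"
  by (induction C) auto


section \<open>Tagging\<close>

text \<open>The hypothesis is the induction hypothesis of \<open>lift_struct\<close> for the members
  of \<open>\<Gamma>\<close>. Isolating it lets one multiset induction serve both nesting
  connectives and \<open>lift_seq\<close>.\<close>

lemma lift_seq_aux:
  assumes "\<And>s N. s \<in># \<Gamma> \<Longrightarrow> struct_occs s = image_mset f N \<Longrightarrow>
    \<exists>s'. map_struct f s' = s \<and> struct_occs s' = N"
  shows "occs \<Gamma> = image_mset f M \<Longrightarrow> \<exists>\<Gamma>'. map_seq f \<Gamma>' = \<Gamma> \<and> occs \<Gamma>' = M"
  using assms
proof (induction \<Gamma> arbitrary: M)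
  case empty
  then show ?case by simp
next
  case (add s \<Gamma>)
  from add.prems(1) have "image_mset f M = struct_occs s + occs \<Gamma>" by simp
  then obtain M1 M2 where M: "M = M1 + M2" "image_mset f M1 = struct_occs s"
    "image_mset f M2 = occs \<Gamma>" by (rule image_mset_eq_plusE)
  from add.prems(2)[of s M1] M obtain s' where s': "map_struct f s' = s" "struct_occs s' = M1"
    by auto
  from add.IH[of M2] add.prems(2) M obtain \<Gamma>' where "map_seq f \<Gamma>' = \<Gamma>" "occs \<Gamma>' = M2"
    by auto
  with s' M show ?case by (intro exI[of _ "add_mset s' \<Gamma>'"]) simp
qed

text \<open>The multiset \<open>M\<close> is split among the branches in the way the occurrences
  are. Prescribing \<open>M\<close> exactly, and not only its image, preserves distinctness of
  tags.\<close>

lemma lift_struct: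
  "struct_occs s = image_mset f M \<Longrightarrow> \<exists>s'. map_struct f s' = s \<and> struct_occs s' = M"
proof (induction s arbitrary: M)
  case (Fm a)
  then obtain b where "M = {#b#}" "f b = a" by (auto elim: image_mset_eq_add_msetE[OF sym])
  then show ?case by (intro exI[of _ "Fm b"]) simp
next
  case (Circ \<Gamma>)
  then obtain \<Gamma>' where "map_seq f \<Gamma>' = \<Gamma> \<and> occs \<Gamma>' = M"
    using lift_seq_aux[of \<Gamma> f M] by auto
  then show ?case by (intro exI[of _ "Circ \<Gamma>'"]) simp
next
  case (Bull \<Gamma>)
  then obtain \<Gamma>' where "map_seq f \<Gamma>' = \<Gamma> \<and> occs \<Gamma>' = M"
    using lift_seq_aux[of \<Gamma> f M] by auto
  then show ?case by (intro exI[of _ "Bull \<Gamma>'"]) simp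
qed

lemma lift_seq: "occs \<Gamma> = image_mset f M \<Longrightarrow> \<exists>\<Gamma>'. map_seq f \<Gamma>' = \<Gamma> \<and> occs \<Gamma>' = M"
  by (rule lift_seq_aux) (auto intro: lift_struct)

lemma lift_ctx:
  "occs (fill C {#}) = image_mset f M \<Longrightarrow> \<exists>C'. map_ctx f C' = C \<and> occs (fill C' {#}) = M"
proof (induction C arbitrary: M)
  case (CHole \<Gamma>)
  then obtain \<Gamma>' where "map_seq f \<Gamma>' = \<Gamma> \<and> occs \<Gamma>' = M" using lift_seq[of \<Gamma> f M] by auto
  then show ?case by (intro exI[of _ "CHole \<Gamma>'"]) simp
next
  case (CCirc \<Gamma> C)
  from CCirc.prems have "image_mset f M = occs \<Gamma> + occs (fill C {#})" by (simp add: add.commute)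
  then obtain M1 M2 where M: "M = M1 + M2" "image_mset f M1 = occs \<Gamma>"
    "image_mset f M2 = occs (fill C {#})" by (rule image_mset_eq_plusE)
  from lift_seq[of \<Gamma> f M1] M obtain \<Gamma>' where G: "map_seq f \<Gamma>' = \<Gamma>" "occs \<Gamma>' = M1" by auto
  from CCirc.IH[of M2] M obtain C' where "map_ctx f C' = C" "occs (fill C' {#}) = M2" by auto
  with G M show ?case by (intro exI[of _ "CCirc \<Gamma>' C'"]) simp
next
  case (CBull \<Gamma> C)
  from CBull.prems have "image_mset f M = occs \<Gamma> + occs (fill C {#})" by (simp add: add.commute)
  then obtain M1 M2 where M: "M = M1 + M2" "image_mset f M1 = occs \<Gamma>"
    "image_mset f M2 = occs (fill C {#})" by (rule image_mset_eq_plusE)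
  from lift_seq[of \<Gamma> f M1] M obtain \<Gamma>' where G: "map_seq f \<Gamma>' = \<Gamma>" "occs \<Gamma>' = M1" by auto
  from CBull.IH[of M2] M obtain C' where "map_ctx f C' = C" "occs (fill C' {#}) = M2" by auto
  with G M show ?case by (intro exI[of _ "CBull \<Gamma>' C'"]) simp
qed

lemma tag_mset:
  "\<exists>M'. image_mset snd M' = M \<and> distinct_tags M' \<and> (\<forall>((w, k), A) \<in># M'. w = v)"
proof -
  obtain xs where xs: "mset xs = M" using ex_mset by blast
  let ?ts = "map (Pair v) [0..<length xs]"
  have "image_mset snd (mset (zip ?ts xs)) = M"
    by (metis length_map length_upt diff_zero map_snd_zip mset_map xs)
  moreover have "image_mset fst (mset (zip ?ts xs)) = mset ?ts"
    by (metis length_map length_upt diff_zero map_fst_zip mset_map)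
  moreover have "distinct ?ts" by (simp add: distinct_map inj_on_def)
  then have "\<forall>t. count (mset ?ts) t \<le> 1" by (simp add: distinct_count_atmost_1)
  moreover have "\<forall>((w, k), A) \<in># mset (zip ?ts xs). w = v" by (auto dest!: set_zip_leftD)
  ultimately show ?thesis unfolding distinct_tags_def by metis
qed

definition map_val :: "('a \<Rightarrow> 'b) \<Rightarrow> 'a valuation \<Rightarrow> 'b valuation" where
  "map_val f \<sigma> = \<lparr>val_seq = (\<lambda>i. map_seq f (val_seq \<sigma> i)), val_fm = (\<lambda>i. f (val_fm \<sigma> i)),
     val_ctx = (\<lambda>i. map_ctx f (val_ctx \<sigma> i))\<rparr>"

lemma inst_item_map_val: "inst_item (map_val f \<sigma>) s = map_seq f (inst_item \<sigma> s)"
  by (induction s)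
    (auto simp: map_val_def map_seq_fill image_mset_sum_mset image_mset.compositionality comp_def
      intro!: arg_cong[of _ _ sum_mset] arg_cong[of _ _ "fill _"] image_mset_cong)

lemma inst_map_val: "inst (map_val f \<sigma>) p = map_seq f (inst \<sigma> p)"
  by (auto simp: inst_def inst_item_map_val image_mset_sum_mset image_mset.compositionality
      comp_def intro!: arg_cong[of _ _ sum_mset] image_mset_cong)

text \<open>Linearity and substitution closure speak of tagged valuations; this carries them over to
  all instances. Each metavariable is tagged on its own, by numbering its occurrences.\<close>

lemma ex_tagged: "\<exists>\<tau>. tagged \<tau> \<and> map_val snd \<tau> = \<sigma>"
proof -
  let ?ok = "\<lambda>v M. distinct_tags M \<and> (\<forall>((w, k), A) \<in># M. w = v)"
  have "\<exists>\<Gamma>. map_seq snd \<Gamma> = val_seq \<sigma> i \<and> ?ok (MSeq i) (occs \<Gamma>)" for i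
  proof -
    obtain M where M: "image_mset snd M = occs (val_seq \<sigma> i)" "?ok (MSeq i) M"
      using tag_mset by blast
    from lift_seq[OF M(1)[symmetric]] M(2) show ?thesis by blast
  qed
  then have "\<forall>i. \<exists>\<Gamma>. map_seq snd \<Gamma> = val_seq \<sigma> i \<and> ?ok (MSeq i) (occs \<Gamma>)" by blast
  from choice[OF this] obtain s where
    s: "\<And>i. map_seq snd (s i) = val_seq \<sigma> i" "\<And>i. ?ok (MSeq i) (occs (s i))"
    by blast
  have "\<exists>C. map_ctx snd C = val_ctx \<sigma> i \<and> ?ok (MCtx i) (occs (fill C {#}))" for i
  proof -
    obtain M where M: "image_mset snd M = occs (fill (val_ctx \<sigma> i) {#})" "?ok (MCtx i) M"
      using tag_mset by blast
    from lift_ctx[OF M(1)[symmetric]] M(2) show ?thesis by blast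
  qed
  then have "\<forall>i. \<exists>C. map_ctx snd C = val_ctx \<sigma> i \<and> ?ok (MCtx i) (occs (fill C {#}))" by blast
  from choice[OF this] obtain c where
    c: "\<And>i. map_ctx snd (c i) = val_ctx \<sigma> i" "\<And>i. ?ok (MCtx i) (occs (fill (c i) {#}))"
    by blast
  \<comment> \<open>A formula metavariable has a single occurrence, so the number 0 is
    enough.\<close>
  define \<tau> where "\<tau> = \<lparr>val_seq = s, val_fm = (\<lambda>i. ((MFm i, 0), val_fm \<sigma> i)), val_ctx = c\<rparr>"
  have "?ok v (mvar_occs \<tau> v)" for v
    using s(2) c(2) by (cases v) (simp_all add: \<tau>_def distinct_tags_def)
  then have "tagged \<tau>" unfolding tagged_def by blast
  moreover have "map_val snd \<tau> = \<sigma>" by (simp add: map_val_def \<tau>_def s c)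
  ultimately show ?thesis by blast
qed


section \<open>Simultaneous substitution in instances of structural rules\<close>

lemma instance_tagged:
  assumes "linear_rule R" "(P, Q) \<in> instances R"
  obtains \<tau> p q where "tagged \<tau>" "(p, q) \<in> R" "P = map_seq snd (inst \<tau> p)"
    "Q = map_seq snd (inst \<tau> q)" "occs (inst \<tau> p) = occs (inst \<tau> q)"
proof -
  from assms(2) obtain \<sigma> p q where pq: "(p, q) \<in> R" "P = inst \<sigma> p" "Q = inst \<sigma> q"
    unfolding instances_def by blast
  obtain \<tau> where "tagged \<tau>" "map_val snd \<tau> = \<sigma>" using ex_tagged by blast
  then have "P = map_seq snd (inst \<tau> p)" "Q = map_seq snd (inst \<tau> q)"
    using pq(2,3) inst_map_val by metis+
  moreover have "occs (inst \<tau> p) = occs (inst \<tau> q)"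
    using assms(1) pq(1) \<open>tagged \<tau>\<close> unfolding linear_rule_def by blast
  ultimately show thesis using that pq(1) \<open>tagged \<tau>\<close> by blast
qed

lemma instance_occs:
  assumes "linear_rule R" "(P, Q) \<in> instances R"
  shows "occs P = occs Q"
  by (rule instance_tagged[OF assms]) (simp add: occs_map_seq)

text \<open>The displayed occurrence carries a tag in the conclusion, and linearity provides the
  same tagged leaf in the premise. Its context with tags erased is \<open>C'\<close>, which does not
  depend on \<open>\<Delta>\<close>.\<close>

lemma instance_replace_one:
  assumes "linear_rule R" "substitution_closed R" "(P, fill C {#Fm A#}) \<in> instances R"
  obtains C' where "P = fill C' {#Fm A#}" "\<forall>\<Delta>. (fill C' \<Delta>, fill C \<Delta>) \<in> instances R"
proof -
  obtain \<tau> p q where \<tau>: "tagged \<tau>" "(p, q) \<in> R" "P = map_seq snd (inst \<tau> p)"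
    "fill C {#Fm A#} = map_seq snd (inst \<tau> q)" "occs (inst \<tau> p) = occs (inst \<tau> q)"
    using instance_tagged[OF assms(1,3)] by blast
  from map_seq_eq_fill[OF \<tau>(4)[symmetric]] obtain D u
    where "inst \<tau> q = fill D {#Fm u#}" "map_ctx snd D = C" "snd u = A" by blast
  then obtain t where D: "inst \<tau> q = fill D {#Fm (t, A)#}" "map_ctx snd D = C"
    by (cases u) simp
  then have "(t, A) \<in># occs (inst \<tau> p)" using \<tau>(5) by (simp add: occs_fill_Fm)
  then obtain D' where D': "inst \<tau> p = fill D' {#Fm (t, A)#}" by (rule occs_fillE)
  have "(fill (map_ctx snd D') \<Delta>, fill C \<Delta>) \<in> instances R" for \<Delta>
    using assms(2)[unfolded substitution_closed_def, THEN bspec, OF \<tau>(2)] \<tau>(1) D D' by blast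
  moreover have "P = fill (map_ctx snd D') {#Fm A#}" using \<tau>(3) D' by (simp add: map_seq_fill)
  ultimately show thesis using that by blast
qed

text \<open>Marked sequents: the leaf \<open>None\<close> marks the occurrences to be substituted.\<close>

abbreviation plug_fm :: "'a \<Rightarrow> 'a option nseq \<Rightarrow> 'a nseq" where
  "plug_fm A \<equiv> map_seq (case_option A id)"

abbreviation plug :: "'a nseq \<Rightarrow> 'a option nseq \<Rightarrow> 'a nseq" where
  "plug \<Delta> \<equiv> bind_seq (case_option \<Delta> (\<lambda>B. {#Fm B#}))"

text \<open>Marks are replaced one at a time, by induction on their number. As each new instance may
  be matched differently, the only invariant kept for the premise is its form after \<open>x\<close>
  is read as \<open>A\<close>.\<close>

lemma instance_replace_marked_by_fm:
  assumes "linear_rule R" "substitution_closed R"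
  shows "(P, plug_fm A Q) \<in> instances R \<Longrightarrow>
    \<exists>P'. (P', plug_fm x Q) \<in> instances R \<and>
      map_seq (\<lambda>B. if B = x then A else B) P' = map_seq (\<lambda>B. if B = x then A else B) P"
proof (induction "count (occs Q) None" arbitrary: P Q)
  case 0
  then have "None \<notin># occs Q" by (simp add: not_in_iff)
  then have "plug_fm A Q = plug_fm x Q"
    by (intro map_seq_cong) (auto split: option.split)
  with 0(2) show ?case by (intro exI[of _ P]) simp
next
  case (Suc n)
  from Suc.hyps(2) have "None \<in># occs Q" by (intro count_inI) simp
  then obtain C where Q: "Q = fill C {#Fm None#}" by (rule occs_fillE)
  with Suc.prems have "(P, fill (map_ctx (case_option A id) C) {#Fm A#}) \<in> instances R"
    by (simp add: map_seq_fill)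
  then obtain C' where C': "P = fill C' {#Fm A#}"
    "\<forall>\<Delta>. (fill C' \<Delta>, fill (map_ctx (case_option A id) C) \<Delta>) \<in> instances R"
    by (rule instance_replace_one[OF assms])
  \<comment> \<open>Writing \<open>Some x\<close> for one mark lowers the count, and
    \<open>plug_fm A\<close> and \<open>plug_fm x\<close> both read that leaf as
    \<open>x\<close>.\<close>
  have n: "n = count (occs (fill C {#Fm (Some x)#})) None"
    using Suc.hyps(2) unfolding Q by (simp add: occs_fill_Fm)
  have "(fill C' {#Fm x#}, plug_fm A (fill C {#Fm (Some x)#})) \<in> instances R"
    using C'(2) by (simp add: map_seq_fill)
  from Suc.hyps(1)[OF n this] obtain P' where
    "(P', plug_fm x (fill C {#Fm (Some x)#})) \<in> instances R"
    "map_seq (\<lambda>B. if B = x then A else B) P' =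
      map_seq (\<lambda>B. if B = x then A else B) (fill C' {#Fm x#})"
    by blast
  then show ?case unfolding Q C'(1) by (intro exI[of _ P']) (simp add: map_seq_fill)
qed

text \<open>Each step replaces one \<open>x\<close> of the conclusion, with its partner in the
  premise, by \<open>\<Delta>\<close>. Freshness makes the count of \<open>x\<close> drop by one and
  makes \<open>g\<close> fix \<open>\<Delta>\<close>, so the step does not change the final result
  of the substitution.\<close>

lemma instance_replace_fresh:
  assumes "linear_rule R" "substitution_closed R" and fresh: "x \<notin># occs \<Delta>"
  defines "g \<equiv> (\<lambda>B. if B = x then \<Delta> else {#Fm B#})"
  shows "(P, Q) \<in> instances R \<Longrightarrow> (bind_seq g P, bind_seq g Q) \<in> instances R"
proof (induction "count (occs Q) x" arbitrary: P Q)
  case 0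
  \<comment> \<open>Linearity carries the absence of \<open>x\<close> from \<open>Q\<close> over to
    \<open>P\<close>.\<close>
  moreover from this have "occs P = occs Q" using instance_occs[OF assms(1)] by blast
  ultimately have "bind_seq g P = P" "bind_seq g Q = Q"
    by (auto intro!: bind_seq_ident simp: g_def count_eq_zero_iff)
  with 0 show ?case by simp
next
  case (Suc n)
  from Suc.hyps(2) have "x \<in># occs Q" by (intro count_inI) simp
  then obtain C where Q: "Q = fill C {#Fm x#}" by (rule occs_fillE)
  obtain C' where
    C': "P = fill C' {#Fm x#}" "\<forall>\<Delta>. (fill C' \<Delta>, fill C \<Delta>) \<in> instances R"
    by (rule instance_replace_one[OF assms(1,2) Suc.prems[unfolded Q]])
  have "n = count (occs (fill C \<Delta>)) x"
    using Suc.hyps(2) fresh unfolding Q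
    by (simp add: occs_fill_Fm occs_fill[of C \<Delta>] not_in_iff)
  from Suc.hyps(1)[OF this C'(2)[rule_format]]
  have "(bind_seq g (fill C' \<Delta>), bind_seq g (fill C \<Delta>)) \<in> instances R" .
  moreover have "bind_seq g \<Delta> = bind_seq g {#Fm x#}"
    using fresh by (auto intro!: bind_seq_ident simp: g_def)
  ultimately show ?case unfolding Q C'(1) using bind_seq_fill_cong[of g \<Delta> "{#Fm x#}"] by simp
qed

lemma infinite_fm: "infinite (UNIV :: fm set)"
proof
  assume "finite (UNIV :: fm set)"
  then have "finite (range Pos)" by (rule rev_finite_subset) simp
  then show False using finite_imageD[of Pos UNIV] by (simp add: inj_def)
qed

text \<open>Passing through a fresh \<open>x\<close> exposes which occurrences of \<open>A\<close>
  in the premise answer to the marks in the conclusion: those where the intermediate premise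
  \<open>P1\<close> has \<open>x\<close>.\<close>

lemma instance_replace_marked:
  assumes "linear_rule R" "substitution_closed R" "(P, plug_fm A Q) \<in> instances R"
  obtains P' where "P = plug_fm A P'" "(plug \<Delta> P', plug \<Delta> Q) \<in> instances R"
proof -
  obtain x where "x \<notin> set_mset (occs (plug_fm A Q)) \<union> set_mset (occs \<Delta>)"
    using ex_new_if_finite[OF infinite_fm] by (metis finite_UnI finite_set_mset)
  then have x: "x \<notin># occs (plug_fm A Q)" "x \<notin># occs \<Delta>" by auto
  let ?r = "\<lambda>B. if B = x then A else B" and ?m = "\<lambda>B. if B = x then None else Some B"
  from instance_replace_marked_by_fm[OF assms] obtain P1 where
    P1: "(P1, plug_fm x Q) \<in> instances R" "map_seq ?r P1 = map_seq ?r P" by blast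
  \<comment> \<open>By linearity \<open>x\<close> is absent from \<open>P\<close> as well, so
    reading \<open>x\<close> as \<open>A\<close> in \<open>P1\<close> gives back
    \<open>P\<close>.\<close>
  have "map_seq ?r P = P"
    using x(1) instance_occs[OF assms(1,3)] by (intro map_seq_ident) auto
  moreover have "plug_fm A (map_seq ?m P1) = map_seq ?r P1"
    unfolding map_seq_map_seq by (intro map_seq_cong) auto
  ultimately have "P = plug_fm A (map_seq ?m P1)" using P1(2) by simp
  moreover
  have "plug \<Delta> (map_seq ?m P1) = bind_seq (\<lambda>B. if B = x then \<Delta> else {#Fm B#}) P1"
    unfolding bind_seq_map by (intro bind_seq_cong) auto
  moreover
  \<comment> \<open>Hence the leaves \<open>x\<close> of \<open>plug_fm x Q\<close> are exactly
    those that come from marks.\<close>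
  have "B \<noteq> x" if "Some B \<in># occs Q" for B
    using that x(1) by (force simp: occs_map_seq)
  then have "plug \<Delta> Q = bind_seq (\<lambda>B. if B = x then \<Delta> else {#Fm B#}) (plug_fm x Q)"
    unfolding bind_seq_map by (intro bind_seq_cong) (auto split: option.split)
  ultimately show thesis
    using that[of "map_seq ?m P1"] instance_replace_fresh[OF assms(1,2) x(2) P1(1)] by simp
qed


section \<open>Cut elimination\<close>

text \<open>\<open>introducible S A \<Gamma>\<close>: some logical rule (or axiom) with principal formula \<open>A\<close> and
  cut-free derivable premises yields \<open>\<Gamma>, A\<close>.\<close>

fun introducible :: "structural_rule set \<Rightarrow> fm \<Rightarrow> sequent \<Rightarrow> bool" where
  "introducible S (Pos a) \<Gamma> \<longleftrightarrow> Fm (Neg a) \<in># \<Gamma>"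
| "introducible S (Neg a) \<Gamma> \<longleftrightarrow> Fm (Pos a) \<in># \<Gamma>"
| "introducible S (And A B) \<Gamma> \<longleftrightarrow> SKt_cut_free S (\<Gamma> + {#Fm A#}) \<and> SKt_cut_free S (\<Gamma> + {#Fm B#})"
| "introducible S (Or A B) \<Gamma> \<longleftrightarrow> SKt_cut_free S (\<Gamma> + {#Fm A, Fm B#})"
| "introducible S (Box A) \<Gamma> \<longleftrightarrow> SKt_cut_free S (\<Gamma> + {#Circ {#Fm A#}#})"
| "introducible S (BBox A) \<Gamma> \<longleftrightarrow> SKt_cut_free S (\<Gamma> + {#Bull {#Fm A#}#})"
| "introducible S (Dia A) \<Gamma> \<longleftrightarrow>
    (\<exists>\<Gamma>' \<Delta>. \<Gamma> = \<Gamma>' + {#Circ \<Delta>#} \<and> SKt_cut_free S (\<Gamma>' + {#Circ (\<Delta> + {#Fm A#})#}))"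
| "introducible S (BDia A) \<Gamma> \<longleftrightarrow>
    (\<exists>\<Gamma>' \<Delta>. \<Gamma> = \<Gamma>' + {#Bull \<Delta>#} \<and> SKt_cut_free S (\<Gamma>' + {#Bull (\<Delta> + {#Fm A#})#}))"

section \<open>Tracing the cut formula through a derivation\<close>

text \<open>The two outcomes decide whether the principal formula of a logical rule is an ancestor
  of the cut formula. If unmarked, the rule is applied again after substitution; if marked, the
  hypothesis on \<open>introducible\<close> takes over.\<close>

lemma plug_fm_eq_plus_FmE:
  assumes "plug_fm A M = \<Gamma> + {#Fm B#}"
  obtains N where "M = N + {#Fm (Some B)#}" "plug_fm A N = \<Gamma>"
    | N where "M = N + {#Fm None#}" "plug_fm A N = \<Gamma>" "B = A"
proof -
  from assms have "plug_fm A M = add_mset (Fm B) \<Gamma>" by simp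
  then obtain s N where s: "M = add_mset s N" "map_struct (case_option A id) s = Fm B"
    "plug_fm A N = \<Gamma>" by (rule image_mset_eq_add_msetE)
  from s(2) obtain b where b: "s = Fm b" "case_option A id b = B"
    unfolding map_struct_eq_iff by blast
  show thesis
  proof (cases b)
    case None
    with b s show thesis by (intro that(2)[of N]) simp_all
  next
    case (Some c)
    with b s show thesis by (intro that(1)[of N]) simp_all
  qed
qed

lemma map_seq_eq_plus_CircE:
  assumes "map_seq f M = \<Gamma> + {#Circ \<Delta>#}"
  obtains N L where "M = N + {#Circ L#}" "map_seq f N = \<Gamma>" "map_seq f L = \<Delta>"
proof -
  from assms have "map_seq f M = add_mset (Circ \<Delta>) \<Gamma>" by simp
  then obtain s N where s: "M = add_mset s N" "map_struct f s = Circ \<Delta>" "map_seq f N = \<Gamma>"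
    by (rule image_mset_eq_add_msetE)
  from s(2) obtain L where "s = Circ L" "map_seq f L = \<Delta>"
    unfolding map_struct_eq_iff by blast
  with s show thesis by (intro that[of N L]) simp_all
qed

lemma map_seq_eq_plus_BullE:
  assumes "map_seq f M = \<Gamma> + {#Bull \<Delta>#}"
  obtains N L where "M = N + {#Bull L#}" "map_seq f N = \<Gamma>" "map_seq f L = \<Delta>"
proof -
  from assms have "map_seq f M = add_mset (Bull \<Delta>) \<Gamma>" by simp
  then obtain s N where s: "M = add_mset s N" "map_struct f s = Bull \<Delta>" "map_seq f N = \<Gamma>"
    by (rule image_mset_eq_add_msetE)
  from s(2) obtain L where "s = Bull L" "map_seq f L = \<Delta>"
    unfolding map_struct_eq_iff by blast
  with s show thesis by (intro that[of N L]) simp_all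
qed

text \<open>Induction on the cut-free derivation for all markings \<open>M\<close> of its end
  sequent, since rules may copy marks and move them between depths. Logical rules introduce their
  principal formula at top level, so a marked one meets the hypothesis on
  \<open>introducible\<close> with the rest of the sequent already plugged.\<close>

lemma derivable_plug:
  assumes S: "\<And>R. R \<in> S \<Longrightarrow> linear_rule R \<and> substitution_closed R"
    and A: "\<And>\<Gamma>. introducible S A \<Gamma> \<Longrightarrow> SKt_cut_free S (\<Gamma> + \<Delta>)"
    and "SKt_cut_free S \<Gamma>" "plug_fm A M = \<Gamma>"
  shows "SKt_cut_free S (plug \<Delta> M)"
  using assms(3,4)
proof (induction arbitrary: M rule: derivable.induct)
  case (id \<Gamma> a)
  then have "plug_fm A M = (\<Gamma> + {#Fm (Pos a)#}) + {#Fm (Neg a)#}" by simp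
  then show ?case
  proof (cases rule: plug_fm_eq_plus_FmE)
    case (1 N)
    from 1(2) show ?thesis
    proof (cases rule: plug_fm_eq_plus_FmE)
      case (1 L)
      then show ?thesis using \<open>M = _\<close> derivable.id[of False S "plug \<Delta> L" a] by simp
    next
      case (2 L)
      then show ?thesis using \<open>M = _\<close> A[of "plug \<Delta> L + {#Fm (Neg a)#}"] by (auto simp: ac_simps)
    qed
  next
    case (2 N)
    from 2(2) show ?thesis
    proof (cases rule: plug_fm_eq_plus_FmE)
      case (1 L)
      then show ?thesis using 2 A[of "plug \<Delta> L + {#Fm (Pos a)#}"] by (auto simp: ac_simps)
    \<comment> \<open>Marking both leaves would make \<open>A\<close> equal to \<open>Pos a\<close>
      and to \<open>Neg a\<close>.\<close>
    qed (use 2 in auto)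
  qed
next
  \<comment> \<open>The flag is \<open>False\<close>, so this rule cannot have been used.\<close>
  case (cut \<Gamma> A \<Delta>)
  then show ?case by simp
next
  case (conj \<Gamma> B C)
  from conj.prems show ?case
  proof (cases rule: plug_fm_eq_plus_FmE)
    case (1 N)
    then show ?thesis
      \<comment> \<open>The placeholder stands for either conjunct, which enters its premise
        unmarked.\<close>
      using conj.IH[of "N + {#Fm (Some _)#}"] derivable.conj[of False S "plug \<Delta> N" B C] by simp
  next
    case (2 N)
    then show ?thesis
      using conj.IH[of "N + {#Fm (Some _)#}"] A[of "plug \<Delta> N"] by (auto simp: ac_simps)
  qed
next
  case (disj \<Gamma> B C)
  from disj.prems show ?case
  proof (cases rule: plug_fm_eq_plus_FmE)
    case (1 N)
    then show ?thesis
      using disj.IH[of "N + {#Fm (Some B), Fm (Some C)#}"] derivable.disj[of False S "plug \<Delta> N" B C]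
      by (simp add: add_mset_commute)
  next
    case (2 N)
    then show ?thesis
      using disj.IH[of "N + {#Fm (Some B), Fm (Some C)#}"] A[of "plug \<Delta> N"]
      by (auto simp: ac_simps add_mset_commute)
  qed
next
  case (ctr \<Gamma> \<Theta>)
  from ctr.prems obtain N L where "M = N + L" "plug_fm A N = \<Gamma>" "plug_fm A L = \<Theta>"
    by (rule image_mset_eq_plusE)
  \<comment> \<open>Both copies in the premise inherit the marking \<open>L\<close> of the
    contracted part.\<close>
  then show ?case using ctr.IH[of "N + L + L"] derivable.ctr[of False S "plug \<Delta> N" "plug \<Delta> L"]
    by simp
next
  case (wk \<Gamma> \<Theta>)
  from wk.prems obtain N L where "M = N + L" "plug_fm A N = \<Gamma>" "plug_fm A L = \<Theta>"
    by (rule image_mset_eq_plusE)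
  then show ?case using wk.IH[of N] by (simp add: derivable.wk)
next
  case (rf \<Gamma> \<Theta>)
  from rf.prems have "plug_fm A M = \<Theta> + {#Bull \<Gamma>#}" by simp
  then obtain N L where "M = N + {#Bull L#}" "plug_fm A N = \<Theta>" "plug_fm A L = \<Gamma>"
    by (rule map_seq_eq_plus_BullE)
  then show ?case using rf.IH[of "L + {#Circ N#}"] derivable.rf[of False S "plug \<Delta> L" "plug \<Delta> N"]
    by simp
next
  case (rp \<Gamma> \<Theta>)
  from rp.prems have "plug_fm A M = \<Theta> + {#Circ \<Gamma>#}" by simp
  then obtain N L where "M = N + {#Circ L#}" "plug_fm A N = \<Theta>" "plug_fm A L = \<Gamma>"
    by (rule map_seq_eq_plus_CircE)
  then show ?case using rp.IH[of "L + {#Bull N#}"] derivable.rp[of False S "plug \<Delta> L" "plug \<Delta> N"]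
    by simp
next
  case (bbox \<Gamma> B)
  from bbox.prems show ?case
  proof (cases rule: plug_fm_eq_plus_FmE)
    case (1 N)
    then show ?thesis using bbox.IH[of "N + {#Bull {#Fm (Some B)#}#}"]
        derivable.bbox[of False S "plug \<Delta> N" B] by simp
  next
    case (2 N)
    then show ?thesis using bbox.IH[of "N + {#Bull {#Fm (Some B)#}#}"] A[of "plug \<Delta> N"]
      by (auto simp: ac_simps)
  qed
next
  case (box \<Gamma> B)
  from box.prems show ?case
  proof (cases rule: plug_fm_eq_plus_FmE)
    case (1 N)
    then show ?thesis using box.IH[of "N + {#Circ {#Fm (Some B)#}#}"]
        derivable.box[of False S "plug \<Delta> N" B] by simp
  next
    case (2 N)
    then show ?thesis using box.IH[of "N + {#Circ {#Fm (Some B)#}#}"] A[of "plug \<Delta> N"]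
      by (auto simp: ac_simps)
  qed
next
  case (bdia \<Gamma> \<Theta> B)
  have *: "SKt_cut_free S (plug \<Delta> N + {#Bull (plug \<Delta> L + {#Fm B#})#})"
    if "plug_fm A N = \<Gamma>" "plug_fm A L = \<Theta>" for N L
    using bdia.IH[of "N + {#Bull (L + {#Fm (Some B)#})#}"] that by simp
  from bdia.prems show ?case
  proof (cases rule: plug_fm_eq_plus_FmE)
    case (1 N)
    from 1(2) obtain K L where K: "N = K + {#Bull L#}" "plug_fm A K = \<Gamma>" "plug_fm A L = \<Theta>"
      by (rule map_seq_eq_plus_BullE)
    show ?thesis using derivable.bdia[OF *[OF K(2,3)]] 1 K by (simp add: add_mset_commute)
  next
    case (2 N)
    from 2(2) obtain K L where K: "N = K + {#Bull L#}" "plug_fm A K = \<Gamma>" "plug_fm A L = \<Theta>"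
      by (rule map_seq_eq_plus_BullE)
    \<comment> \<open>Plugging leaves the outer \<open>Bull\<close> in place, so the sequent has the
      shape that introducing \<open>BDia B\<close> demands.\<close>
    have "introducible S A (plug \<Delta> K + {#Bull (plug \<Delta> L)#})" using *[OF K(2,3)] 2(3)[symmetric] by auto
    from A[OF this] show ?thesis using 2 K by (simp add: ac_simps add_mset_commute)
  qed
next
  case (dia \<Gamma> \<Theta> B)
  have *: "SKt_cut_free S (plug \<Delta> N + {#Circ (plug \<Delta> L + {#Fm B#})#})"
    if "plug_fm A N = \<Gamma>" "plug_fm A L = \<Theta>" for N L
    using dia.IH[of "N + {#Circ (L + {#Fm (Some B)#})#}"] that by simp
  from dia.prems show ?case
  proof (cases rule: plug_fm_eq_plus_FmE)
    case (1 N)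
    from 1(2) obtain K L where K: "N = K + {#Circ L#}" "plug_fm A K = \<Gamma>" "plug_fm A L = \<Theta>"
      by (rule map_seq_eq_plus_CircE)
    show ?thesis using derivable.dia[OF *[OF K(2,3)]] 1 K by (simp add: add_mset_commute)
  next
    case (2 N)
    from 2(2) obtain K L where K: "N = K + {#Circ L#}" "plug_fm A K = \<Gamma>" "plug_fm A L = \<Theta>"
      by (rule map_seq_eq_plus_CircE)
    have "introducible S A (plug \<Delta> K + {#Circ (plug \<Delta> L)#})" using *[OF K(2,3)] 2(3)[symmetric] by auto
    from A[OF this] show ?thesis using 2 K by (simp add: ac_simps add_mset_commute)
  qed
next
  case (structural R P Q)
  with S have "linear_rule R" "substitution_closed R" "(P, plug_fm A M) \<in> instances R" by auto
  \<comment> \<open>The marking \<open>P'\<close> of the premise comes from the replacement result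
    for \<open>R\<close>; the induction hypothesis covers it because it holds for every
    marking.\<close>
  then obtain P' where "P = plug_fm A P'" "(plug \<Delta> P', plug \<Delta> M) \<in> instances R"
    by (rule instance_replace_marked)
  with structural show ?case by (metis derivable.structural)
qed

text \<open>Only the displayed \<open>A\<close> is marked; copies of \<open>A\<close> inside
  \<open>\<Gamma>\<close> stay as they are.\<close>

lemma cut_introducible:
  assumes S: "\<And>R. R \<in> S \<Longrightarrow> linear_rule R \<and> substitution_closed R"
    and A: "\<And>\<Gamma>. introducible S A \<Gamma> \<Longrightarrow> SKt_cut_free S (\<Gamma> + \<Delta>)"
    and "SKt_cut_free S (\<Gamma> + {#Fm A#})"
  shows "SKt_cut_free S (\<Gamma> + \<Delta>)"
proof -
  have \<Gamma>: "plug_fm A (map_seq Some \<Gamma>) = \<Gamma>"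
    unfolding map_seq_map_seq by (rule map_seq_ident) simp
  have "plug \<Delta> (map_seq Some \<Gamma>) = \<Gamma>"
    unfolding bind_seq_map by (rule bind_seq_ident) simp
  with derivable_plug[OF S A assms(3), where M = "map_seq Some \<Gamma> + {#Fm None#}"] \<Gamma>
  show ?thesis by (simp add: ac_simps)
qed

section \<open>Reduction of principal cuts to cuts on subformulae\<close>

text \<open>Weakening both premises to the same context lets the contraction after the inner cut act on a
  single structure, which is then displayed back.\<close>

lemma cut_Circ:
  assumes cut: "\<And>\<Gamma> \<Delta>. SKt_cut_free S (\<Gamma> + {#Fm A#}) \<Longrightarrow> SKt_cut_free S (\<Delta> + {#Fm B#}) \<Longrightarrow>
      SKt_cut_free S (\<Gamma> + \<Delta>)"
    and 1: "SKt_cut_free S (\<Gamma> + {#Circ {#Fm A#}#})"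
    and 2: "SKt_cut_free S (\<Delta> + {#Circ (\<Theta> + {#Fm B#})#})"
  shows "SKt_cut_free S (\<Gamma> + \<Delta> + {#Circ \<Theta>#})"
proof -
  have "SKt_cut_free S ((\<Gamma> + \<Delta>) + {#Circ {#Fm A#}#})"
    using derivable.wk[OF 1, of \<Delta>] by (simp add: ac_simps)
  \<comment> \<open>\<open>rf\<close> displays the subformula at top level, the only place where a
    cut can act.\<close>
  from derivable.rf[OF this] have a: "SKt_cut_free S ({#Bull (\<Gamma> + \<Delta>)#} + {#Fm A#})" .
  have "SKt_cut_free S ((\<Gamma> + \<Delta>) + {#Circ (\<Theta> + {#Fm B#})#})"
    using derivable.wk[OF 2, of \<Gamma>] by (simp add: ac_simps)
  from derivable.rf[OF this] have "SKt_cut_free S (({#Bull (\<Gamma> + \<Delta>)#} + \<Theta>) + {#Fm B#})"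
    by (simp add: ac_simps)
  from cut[OF a this] have "SKt_cut_free S (\<Theta> + {#Bull (\<Gamma> + \<Delta>)#} + {#Bull (\<Gamma> + \<Delta>)#})"
    by (simp add: ac_simps)
  from derivable.rp[OF derivable.ctr[OF this]] show ?thesis by (simp add: ac_simps)
qed

lemma cut_Bull:
  assumes cut: "\<And>\<Gamma> \<Delta>. SKt_cut_free S (\<Gamma> + {#Fm A#}) \<Longrightarrow> SKt_cut_free S (\<Delta> + {#Fm B#}) \<Longrightarrow>
      SKt_cut_free S (\<Gamma> + \<Delta>)"
    and 1: "SKt_cut_free S (\<Gamma> + {#Bull {#Fm A#}#})"
    and 2: "SKt_cut_free S (\<Delta> + {#Bull (\<Theta> + {#Fm B#})#})"
  shows "SKt_cut_free S (\<Gamma> + \<Delta> + {#Bull \<Theta>#})"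
proof -
  have "SKt_cut_free S ((\<Gamma> + \<Delta>) + {#Bull {#Fm A#}#})"
    using derivable.wk[OF 1, of \<Delta>] by (simp add: ac_simps)
  from derivable.rp[OF this] have a: "SKt_cut_free S ({#Circ (\<Gamma> + \<Delta>)#} + {#Fm A#})" .
  have "SKt_cut_free S ((\<Gamma> + \<Delta>) + {#Bull (\<Theta> + {#Fm B#})#})"
    using derivable.wk[OF 2, of \<Gamma>] by (simp add: ac_simps)
  from derivable.rp[OF this] have "SKt_cut_free S (({#Circ (\<Gamma> + \<Delta>)#} + \<Theta>) + {#Fm B#})"
    by (simp add: ac_simps)
  from cut[OF a this] have "SKt_cut_free S (\<Theta> + {#Circ (\<Gamma> + \<Delta>)#} + {#Circ (\<Gamma> + \<Delta>)#})"
    by (simp add: ac_simps)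
  from derivable.rf[OF derivable.ctr[OF this]] show ?thesis by (simp add: ac_simps)
qed

text \<open>The conjunction side is used twice, once for each component, and its doubled context is
  contracted. Separate \<open>A'\<close> and \<open>B'\<close> let the reduction serve either
  orientation of a formula and its dual.\<close>

lemma cut_And_Or:
  assumes cut1: "\<And>\<Gamma> \<Delta>. SKt_cut_free S (\<Gamma> + {#Fm A#}) \<Longrightarrow> SKt_cut_free S (\<Delta> + {#Fm A'#}) \<Longrightarrow>
      SKt_cut_free S (\<Gamma> + \<Delta>)"
    and cut2: "\<And>\<Gamma> \<Delta>. SKt_cut_free S (\<Gamma> + {#Fm B#}) \<Longrightarrow> SKt_cut_free S (\<Delta> + {#Fm B'#}) \<Longrightarrow>
      SKt_cut_free S (\<Gamma> + \<Delta>)"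
    and 1: "SKt_cut_free S (\<Gamma> + {#Fm A#})" and 2: "SKt_cut_free S (\<Gamma> + {#Fm B#})"
    and 3: "SKt_cut_free S (\<Delta> + {#Fm A', Fm B'#})"
  shows "SKt_cut_free S (\<Gamma> + \<Delta>)"
proof -
  have "SKt_cut_free S ((\<Delta> + {#Fm B'#}) + {#Fm A'#})" using 3 by (simp add: add_mset_commute)
  from cut1[OF 1 this] have "SKt_cut_free S ((\<Gamma> + \<Delta>) + {#Fm B'#})" by (simp add: ac_simps)
  from cut2[OF 2 this] have "SKt_cut_free S (\<Delta> + \<Gamma> + \<Gamma>)" by (simp add: ac_simps)
  from derivable.ctr[OF this] show ?thesis by (simp add: ac_simps)
qed

lemma derivable_id:
  assumes "Fm (Pos a) \<in># \<Gamma>" "Fm (Neg a) \<in># \<Gamma>"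
  shows "derivable c S \<Gamma>"
proof -
  from assms(1) obtain \<Theta> where \<Theta>: "\<Gamma> = add_mset (Fm (Pos a)) \<Theta>"
    by (rule mset_add)
  with assms(2) have "Fm (Neg a) \<in># \<Theta>" by simp
  then obtain \<Delta> where "\<Theta> = add_mset (Fm (Neg a)) \<Delta>" by (rule mset_add)
  with \<Theta> have "\<Gamma> = \<Delta> + {#Fm (Pos a), Fm (Neg a)#}" by (simp add: add_mset_commute)
  then show ?thesis using derivable.id by simp
qed

text \<open>Both cut formulae have just been introduced, so the premises of the two introductions
  can be cut against each other on immediate subformulae.\<close>

lemma principal_cut:
  assumes S: "\<And>R. R \<in> S \<Longrightarrow> linear_rule R \<and> substitution_closed R"
    and cut: "\<And>B \<Gamma> \<Delta>. size B < size A \<Longrightarrow> SKt_cut_free S (\<Gamma> + {#Fm B#}) \<Longrightarrow>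
      SKt_cut_free S (\<Delta> + {#Fm (dual B)#}) \<Longrightarrow> SKt_cut_free S (\<Gamma> + \<Delta>)"
    and A: "introducible S A \<Gamma>" "introducible S (dual A) \<Delta>"
  shows "SKt_cut_free S (\<Gamma> + \<Delta>)"
proof -
  \<comment> \<open>The mirrored hypothesis lets \<open>Or\<close>, \<open>Dia\<close> and
    \<open>BDia\<close> reuse the reductions for \<open>And\<close>, \<open>Box\<close> and
    \<open>BBox\<close> with the sides exchanged.\<close>
  have cut': "SKt_cut_free S (\<Gamma> + \<Delta>)" if "size B < size A"
    "SKt_cut_free S (\<Gamma> + {#Fm (dual B)#})" "SKt_cut_free S (\<Delta> + {#Fm B#})" for B \<Gamma> \<Delta>
    using cut[OF that(1,3,2)] by (simp add: add.commute)
  show ?thesis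
  proof (cases A)
    \<comment> \<open>\<open>\<Gamma>\<close> contains the dual literal and \<open>\<Delta>\<close>
      the literal itself, so their sum is an axiom.\<close>
    case (Pos a)
    with A show ?thesis by (auto intro!: derivable_id[of a])
  next
    case (Neg a)
    with A show ?thesis by (auto intro!: derivable_id[of a])
  next
    case (And B C)
    show ?thesis
      by (rule cut_And_Or[OF cut[of B] cut[of C]]) (use A And in auto)
  next
    case (Or B C)
    have "SKt_cut_free S (\<Delta> + \<Gamma>)"
      by (rule cut_And_Or[OF cut'[of B] cut'[of C]]) (use A Or in auto)
    then show ?thesis by (simp add: add.commute)
  next
    case (Box B)
    with A obtain \<Xi> \<Theta> where *: "\<Delta> = \<Xi> + {#Circ \<Theta>#}"
      "SKt_cut_free S (\<Xi> + {#Circ (\<Theta> + {#Fm (dual B)#})#})"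
      by auto
    have "SKt_cut_free S (\<Gamma> + \<Xi> + {#Circ \<Theta>#})"
      by (rule cut_Circ[OF cut[of B]]) (use A Box * in simp_all)
    with * show ?thesis by (simp add: ac_simps)
  next
    case (BBox B)
    with A obtain \<Xi> \<Theta> where *: "\<Delta> = \<Xi> + {#Bull \<Theta>#}"
      "SKt_cut_free S (\<Xi> + {#Bull (\<Theta> + {#Fm (dual B)#})#})"
      by auto
    have "SKt_cut_free S (\<Gamma> + \<Xi> + {#Bull \<Theta>#})"
      by (rule cut_Bull[OF cut[of B]]) (use A BBox * in simp_all)
    with * show ?thesis by (simp add: ac_simps)
  next
    case (Dia B)
    with A obtain \<Xi> \<Theta> where *: "\<Gamma> = \<Xi> + {#Circ \<Theta>#}"
      "SKt_cut_free S (\<Xi> + {#Circ (\<Theta> + {#Fm B#})#})"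
      by auto
    have "SKt_cut_free S (\<Delta> + \<Xi> + {#Circ \<Theta>#})"
      by (rule cut_Circ[OF cut'[of B]]) (use A Dia * in simp_all)
    with * show ?thesis by (simp add: ac_simps)
  next
    case (BDia B)
    with A obtain \<Xi> \<Theta> where *: "\<Gamma> = \<Xi> + {#Bull \<Theta>#}"
      "SKt_cut_free S (\<Xi> + {#Bull (\<Theta> + {#Fm B#})#})"
      by auto
    have "SKt_cut_free S (\<Delta> + \<Xi> + {#Bull \<Theta>#})"
      by (rule cut_Bull[OF cut'[of B]]) (use A BDia * in simp_all)
    with * show ?thesis by (simp add: ac_simps)
  qed
qed

text \<open>Induction on the size of the cut formula. The substitution argument is applied twice: it
  traces \<open>A\<close> on the left and, wherever \<open>A\<close> is principal there, traces
  \<open>dual A\<close> on the right.\<close>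

lemma cut_admissible:
  assumes S: "\<And>R. R \<in> S \<Longrightarrow> linear_rule R \<and> substitution_closed R"
    and "SKt_cut_free S (\<Gamma> + {#Fm A#})" "SKt_cut_free S (\<Delta> + {#Fm (dual A)#})"
  shows "SKt_cut_free S (\<Gamma> + \<Delta>)"
  using assms(2,3)
proof (induction A arbitrary: \<Gamma> \<Delta> rule: measure_induct_rule[of size])
  case (less A)
  have "SKt_cut_free S (\<Theta> + \<Delta>)" if "introducible S A \<Theta>" for \<Theta>
  proof -
    have "SKt_cut_free S (\<Xi> + \<Theta>)" if "introducible S (dual A) \<Xi>" for \<Xi>
      using principal_cut[OF S less.IH \<open>introducible S A \<Theta>\<close> that] by (simp add: add.commute)
    from cut_introducible[OF S this less.prems(2)] show ?thesis by (simp add: add.commute)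
  qed
  from cut_introducible[OF S this less.prems(1)] show ?case .
qed

theorem theorem3p16:
  fixes S :: "structural_rule set"
  assumes "\<And>R. R \<in> S \<Longrightarrow> finite R \<and> linear_rule R \<and> substitution_closed R"
  shows "\<forall>\<Gamma>. SKt S \<Gamma> \<longrightarrow> SKt_cut_free S \<Gamma>"
proof (intro allI impI)
  fix \<Gamma>
  assume "SKt S \<Gamma>"
  then show "SKt_cut_free S \<Gamma>"
  proof (induction rule: derivable.induct)
    \<comment> \<open>By induction both premises have cut-free derivations, so a single cut between
      these is left.\<close>
    case (cut \<Gamma> A \<Delta>)
    then show ?case using cut_admissible[of S \<Gamma> A \<Delta>] assms by blast
  qed (blast intro: derivable.intros)+
qed

end
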